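(* Fix $n\in\mathbb{N}$. The numbers that may appear as denominators of entries in vertices of GT-polytopes in $X_n$ are smaller than $$(n-1)^{\binom{n+1}{2}-n-1}.$$
   Context: For $n\in\mathbb{N}$, $X_n$ is the real vector space of all triangular arrays $(x_{ij})_{1\le i\le j\le n}$ with $x_{ij}\in\mathbb{R}$, so $X_n \cong \mathbb{R}^{n(n+1)/2}$. A Gelfand--Tsetlin pattern (GT-pattern) is an array $(x_{ij})_{1\le i\le j\le n}\in X_n$ with $x_{ij}\ge 0$ for $1\le i\le j\le n$ and $x_{i,j+1}\ge x_{ij}\ge x_{i+1,j+1}$ for $1\le i\le j\le n-1$. For $\lambda,\mu\in\mathbb{Z}^n$, the Gelfand--Tsetlin polytope (GT-polytope) $GT(\lambda,\mu)\subset X_n$ is the convex polytope of all GT-patterns $(x_{ij})_{1\le i\le j\le n}$ with $x_{in}=\lambda_i$ for $1\le i\le n$, $x_{11}=\mu_1$, and $\sum_{i=1}^{j}x_{ij}-\sum_{i=1}^{j-1}x_{i,j-1}=\mu_j$ for $2\le j\le n$. When speaking of a GT-polytope $GT(\lambda,\mu)$, it is always assumed that $\lambda$ and $\mu$ are integral. The vertices of a GT-polytope then have rational entries, and denominators refer to entries written in reduced form.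
   Formalization: The claim is stated for n ≥ 3 only: for n = 1 the bound 0^(-1) is undefined, and for n = 2 it equals 1, which fails since the vertex 0 of GT(0,0) has entries with denominator 1. *)

theory Defs
  imports "HOL-Analysis.Analysis" "HOL-Analysis.Finite_Function_Topology"
begin

text \<open>Arrays are finitely supported functions on index pairs, because these form a real vector
  space in the library (so that \<open>extreme_point_of\<close> applies) for a dimension given by a number;
  the space of triangular arrays is the subspace of those that vanish off the triangle.\<close>

definition triangle :: "nat \<Rightarrow> (nat \<times> nat) set" where
  "triangle n = {(i, j). 1 \<le> i \<and> i \<le> j \<and> j \<le> n}"

definition triangular_arrays :: "nat \<Rightarrow> ((nat \<times> nat) \<Rightarrow>\<^sub>0 real) set" where
  "triangular_arrays n = {x. Poly_Mapping.keys x \<subseteq> triangle n}"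

definition GT_pattern :: "nat \<Rightarrow> ((nat \<times> nat) \<Rightarrow>\<^sub>0 real) \<Rightarrow> bool" where
  "GT_pattern n x \<longleftrightarrow>
     x \<in> triangular_arrays n \<and>
     (\<forall>i j. 1 \<le> i \<and> i \<le> j \<and> j \<le> n \<longrightarrow> Poly_Mapping.lookup x (i, j) \<ge> 0) \<and>
     (\<forall>i j. 1 \<le> i \<and> i \<le> j \<and> j < n \<longrightarrow>
        Poly_Mapping.lookup x (i, j + 1) \<ge> Poly_Mapping.lookup x (i, j) \<and>
        Poly_Mapping.lookup x (i, j) \<ge> Poly_Mapping.lookup x (i + 1, j + 1))"

text \<open>Elements of \<open>\<int>\<^sup>n\<close> are functions of which only the values at \<open>1, \<dots>, n\<close> are used.\<close>

definition GT_polytope ::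
    "nat \<Rightarrow> (nat \<Rightarrow> int) \<Rightarrow> (nat \<Rightarrow> int) \<Rightarrow> ((nat \<times> nat) \<Rightarrow>\<^sub>0 real) set" where
  "GT_polytope n lam mu =
     {x. GT_pattern n x \<and>
         (\<forall>i\<in>{1..n}. Poly_Mapping.lookup x (i, n) = of_int (lam i)) \<and>
         Poly_Mapping.lookup x (1, 1) = of_int (mu 1) \<and>
         (\<forall>j\<in>{2..n}. (\<Sum>i=1..j. Poly_Mapping.lookup x (i, j))
                     - (\<Sum>i=1..j-1. Poly_Mapping.lookup x (i, j - 1)) = of_int (mu j))}"

end

theory Submission
  imports Defs
begin

text \<open>Let \<open>x\<close> be a vertex. Its row sums are integers, so for every \<open>m\<close> the array of
  fractional parts of \<open>m * x\<close> has integral row sums, and the sum of row \<open>j\<close> lies in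
  \<open>{0, \<dots>, j - 1}\<close>. By the pigeonhole principle, two of the multiples \<open>0, \<dots>, (n - 1)!\<close>
  give the same sums in the rows \<open>1, \<dots>, n - 1\<close>. The difference \<open>w\<close> of the two arrays of fractional
  parts is \<open>g\<close> applied entrywise to \<open>x\<close> for a function \<open>g\<close> that vanishes on the integers, so \<open>w\<close>
  respects all equalities between entries of \<open>x\<close>, it vanishes where \<open>x\<close> is integral, and its row sums
  are \<open>0\<close>. Hence \<open>x \<plusminus> \<epsilon> w\<close> stays in the polytope for small \<open>\<epsilon>\<close>, and \<open>w = 0\<close> because \<open>x\<close> is a
  vertex. So all entries of \<open>x\<close> have a common denominator of at most \<open>(n - 1)!\<close>.\<close>

text \<open>A finite set has a least positive gap. Moving two distinct points by at most half of it
  each cannot reverse their order, and equal points move together because the shift depends only on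
  the value.\<close>

lemma monotone_perturbation:
  fixes S :: "real set" and g :: "real \<Rightarrow> real"
  assumes "finite S" and g: "\<And>t. \<bar>g t\<bar> \<le> 1"
  obtains e where "e > 0"
    and "\<And>c s t. \<lbrakk>\<bar>c\<bar> \<le> e; s \<in> S; t \<in> S; s \<le> t\<rbrakk> \<Longrightarrow> s + c * g s \<le> t + c * g t"
proof -
  \<comment> \<open>The element 1 keeps \<open>D\<close> nonempty when \<open>S\<close> has fewer
    than two points.\<close>
  define D where "D = insert 1 ((\<lambda>(s, t). \<bar>s - t\<bar>) ` (S \<times> S) - {0})"
  have fin: "finite D" and ne: "D \<noteq> {}"
    using \<open>finite S\<close> by (auto simp: D_def)
  define e where "e = Min D / 2"
  have "Min D \<in> D"
    using fin ne by (rule Min_in)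
  then have "e > 0"
    by (auto simp: D_def e_def)
  moreover have "s + c * g s \<le> t + c * g t"
    if "\<bar>c\<bar> \<le> e" "s \<in> S" "t \<in> S" "s \<le> t" for c s t
  proof (cases "s = t")
    case False
    have "t - s \<in> D"
      unfolding D_def using that False by (force simp: image_iff)
    then have "2 * e \<le> t - s"
      using fin by (simp add: e_def)
    moreover have "\<bar>c * g r\<bar> \<le> e" for r
      using mult_mono[OF that(1) g[of r]] \<open>e > 0\<close> by (simp add: abs_mult)
    ultimately show ?thesis
      by (smt (verit))
  qed simp
  ultimately show thesis
    by (rule that)
qed

lemma open_segment_symmetric:
  fixes x w :: "'a::real_vector"
  assumes "w \<noteq> 0"
  shows "x \<in> open_segment (x + w) (x - w)"
proof -
  have "x + w \<noteq> x - w"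
  proof
    assume "x + w = x - w"
    then have "2 *\<^sub>R w = 0"
      by (simp add: scaleR_2 eq_diff_eq add.assoc)
    with assms show False
      by simp
  qed
  moreover have "x = (1 - 1/2) *\<^sub>R (x + w) + (1/2) *\<^sub>R (x - w)"
    by (simp add: algebra_simps flip: scaleR_add_left)
  ultimately show ?thesis
    unfolding in_segment by (metis half_gt_zero_iff field_sum_of_halves less_add_same_cancel1 zero_less_one)
qed

lemma lookup_map_zero:
  assumes "f 0 = 0"
  shows "Poly_Mapping.lookup (Poly_Mapping.map f p) k = f (Poly_Mapping.lookup p k)"
  using assms by (simp add: map.rep_eq when_def)

lemma lookup_scaleR:
  "Poly_Mapping.lookup (c *\<^sub>R p) k = c *\<^sub>R Poly_Mapping.lookup p k"
proof -
  have "finite {i. c *\<^sub>R Poly_Mapping.lookup p i \<noteq> 0}"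
    by (rule finite_subset[OF _ finite_lookup[of p]]) auto
  then show ?thesis
    by (simp add: scaleR_poly_mapping_def)
qed

lemma row_sum_integral:
  assumes "x \<in> GT_polytope n lam mu" "1 \<le> j" "j \<le> n"
  shows "(\<Sum>i=1..j. Poly_Mapping.lookup x (i, j)) \<in> \<int>"
  using assms(2,3)
proof (induction j rule: dec_induct)
  case base
  show ?case
    using assms(1) by (simp add: GT_polytope_def)
next
  case (step j)
  have "(\<Sum>i=1..Suc j. Poly_Mapping.lookup x (i, Suc j)) - (\<Sum>i=1..j. Poly_Mapping.lookup x (i, j))
      = of_int (mu (Suc j))"
    using assms(1) step by (auto simp: GT_polytope_def dest!: bspec[where x = "Suc j"])
  then have "(\<Sum>i=1..Suc j. Poly_Mapping.lookup x (i, Suc j))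
      = (\<Sum>i=1..j. Poly_Mapping.lookup x (i, j)) + of_int (mu (Suc j))"
    by linarith
  then show ?case
    using step by simp
qed

text \<open>Every pattern inequality compares two entries or an entry with 0, so an order-preserving
  change of values keeps it; vanishing row sums of the change keep the weight
  \<open>mu\<close>.\<close>

lemma GT_polytope_perturbation:
  fixes g :: "real \<Rightarrow> real"
  assumes x: "x \<in> GT_polytope n lam mu"
    and g1: "\<And>t. \<bar>g t\<bar> \<le> 1" and gZ: "\<And>t. t \<in> \<int> \<Longrightarrow> g t = 0"
    and rows: "\<And>j. \<lbrakk>1 \<le> j; j < n\<rbrakk> \<Longrightarrow> (\<Sum>i=1..j. g (Poly_Mapping.lookup x (i, j))) = 0"
  obtains e where "e > 0"
    and "\<And>c. \<bar>c\<bar> \<le> e \<Longrightarrow> x + c *\<^sub>R Poly_Mapping.map g x \<in> GT_polytope n lam mu"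
proof -
  let ?l = "Poly_Mapping.lookup x"
  \<comment> \<open>0 is the value of \<open>x\<close> off its support, and comparison with it
    yields nonnegativity.\<close>
  define S where "S = insert 0 (?l ` Poly_Mapping.keys x)"
  have S: "?l p \<in> S" "0 \<in> S" for p
    by (auto simp: S_def in_keys_iff)
  have "finite S"
    by (simp add: S_def)
  from monotone_perturbation[of S g, OF this g1] obtain e where "e > 0"
    and mono: "\<And>c s t. \<lbrakk>\<bar>c\<bar> \<le> e; s \<in> S; t \<in> S; s \<le> t\<rbrakk> \<Longrightarrow> s + c * g s \<le> t + c * g t"
    by blast
  have g0: "g 0 = 0"
    by (simp add: gZ)
  have pat: "GT_pattern n x"
    and top: "\<And>i. i \<in> {1..n} \<Longrightarrow> ?l (i, n) = of_int (lam i)"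
    and first: "?l (1, 1) = of_int (mu 1)"
    and diff: "\<And>j. j \<in> {2..n} \<Longrightarrow> (\<Sum>i=1..j. ?l (i, j)) - (\<Sum>i=1..j-1. ?l (i, j - 1)) = of_int (mu j)"
    using x by (auto simp: GT_polytope_def)
  \<comment> \<open>Row \<open>n\<close> is outside \<open>rows\<close>, but its entries are the
    integers \<open>lam i\<close>, where \<open>g\<close> vanishes.\<close>
  have sum0: "(\<Sum>i=1..j. g (?l (i, j))) = 0" if "1 \<le> j" "j \<le> n" for j
  proof (cases "j = n")
    case True
    then show ?thesis
      by (intro sum.neutral) (auto simp: top gZ)
  qed (use rows that in auto)
  have "x + c *\<^sub>R Poly_Mapping.map g x \<in> GT_polytope n lam mu" if c: "\<bar>c\<bar> \<le> e" for c
  proof -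
    let ?y = "x + c *\<^sub>R Poly_Mapping.map g x"
    have l: "Poly_Mapping.lookup ?y p = ?l p + c * g (?l p)" for p
      by (simp add: lookup_add lookup_scaleR lookup_map_zero g0)
    \<comment> \<open>Since \<open>g 0 = 0\<close>, the support cannot grow and the array stays
      triangular.\<close>
    have keys: "Poly_Mapping.keys ?y \<subseteq> Poly_Mapping.keys x"
    proof
      fix p assume "p \<in> Poly_Mapping.keys ?y"
      then show "p \<in> Poly_Mapping.keys x"
        by (metis in_keys_iff l g0 mult_zero_right add_0)
    qed
    have le: "Poly_Mapping.lookup ?y p \<le> Poly_Mapping.lookup ?y q" if "?l p \<le> ?l q" for p q
      unfolding l using mono[OF c S(1) S(1) that] .
    have nonneg: "0 \<le> Poly_Mapping.lookup ?y p" if "0 \<le> ?l p" for p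
      unfolding l using mono[OF c S(2) S(1) that] g0 by simp
    have "GT_pattern n ?y"
      using pat keys le nonneg unfolding GT_pattern_def triangular_arrays_def by blast
    moreover have row: "(\<Sum>i=1..j. Poly_Mapping.lookup ?y (i, j)) = (\<Sum>i=1..j. ?l (i, j))"
      if "1 \<le> j" "j \<le> n" for j
      unfolding l using sum0[OF that] by (simp add: sum.distrib flip: sum_distrib_left)
    have "(\<Sum>i=1..j. Poly_Mapping.lookup ?y (i, j))
        - (\<Sum>i=1..j-1. Poly_Mapping.lookup ?y (i, j - 1)) = of_int (mu j)"
      if "j \<in> {2..n}" for j
      using diff[OF that] row[of j] row[of "j - 1"] that by fastforce
    ultimately show ?thesis
      unfolding GT_polytope_def by (simp add: l top first[simplified] gZ)
  qed
  with \<open>e > 0\<close> show thesis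
    by (rule that)
qed

lemma extreme_point_GT_polytope_rigid:
  fixes g :: "real \<Rightarrow> real"
  assumes x: "x extreme_point_of GT_polytope n lam mu"
    and g1: "\<And>t. \<bar>g t\<bar> \<le> 1" and gZ: "\<And>t. t \<in> \<int> \<Longrightarrow> g t = 0"
    and rows: "\<And>j. \<lbrakk>1 \<le> j; j < n\<rbrakk> \<Longrightarrow> (\<Sum>i=1..j. g (Poly_Mapping.lookup x (i, j))) = 0"
  shows "g (Poly_Mapping.lookup x p) = 0"
proof -
  let ?w = "Poly_Mapping.map g x"
  have "x \<in> GT_polytope n lam mu"
    using x by (simp add: extreme_point_of_def)
  from GT_polytope_perturbation[of x n lam mu g, OF this g1 gZ rows] obtain e where "e > 0"
    and e: "\<And>c. \<bar>c\<bar> \<le> e \<Longrightarrow> x + c *\<^sub>R ?w \<in> GT_polytope n lam mu"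
    by blast
  have "x + e *\<^sub>R ?w \<in> GT_polytope n lam mu" "x - e *\<^sub>R ?w \<in> GT_polytope n lam mu"
    using e[of e] e[of "- e"] \<open>e > 0\<close> by simp_all
  then have "x \<notin> open_segment (x + e *\<^sub>R ?w) (x - e *\<^sub>R ?w)"
    using x by (simp add: extreme_point_of_def)
  then have "e *\<^sub>R ?w = 0"
    using open_segment_symmetric by blast
  with \<open>e > 0\<close> have "?w = 0"
    by simp
  then show ?thesis
    using lookup_map_zero[of g x p] gZ by simp
qed

lemma sum_frac_integral:
  fixes f :: "'a \<Rightarrow> real"
  assumes "sum f A \<in> \<int>"
  shows "(\<Sum>a\<in>A. frac (of_nat m * f a)) \<in> \<int>"
proof -
  have "(\<Sum>a\<in>A. frac (of_nat m * f a))
      = of_nat m * sum f A - of_int (\<Sum>a\<in>A. \<lfloor>of_nat m * f a\<rfloor>)"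
    by (simp add: frac_def sum_subtractf sum_distrib_left)
  then show ?thesis
    using assms by (metis Ints_diff Ints_mult Ints_of_int Ints_of_nat)
qed

lemma extreme_point_GT_polytope_common_denominator:
  assumes x: "x extreme_point_of GT_polytope n lam mu"
  obtains d :: nat where "1 \<le> d" "d \<le> fact (n - 1)"
    and "\<And>p. of_nat d * Poly_Mapping.lookup x p \<in> \<int>"
proof -
  let ?l = "Poly_Mapping.lookup x"
  have xin: "x \<in> GT_polytope n lam mu"
    using x by (simp add: extreme_point_of_def)
  define s where "s m j = (\<Sum>i=1..j. frac (of_nat m * ?l (i, j)))" for m j :: nat
  \<comment> \<open>The sums are integers already, so passing to floors loses nothing: equal floors
    give equal sums.\<close>
  have s_int: "of_int \<lfloor>s m j\<rfloor> = s m j" if "j \<in> {1..<n}" for m j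
    unfolding s_def using that row_sum_integral[OF xin, of j]
    by (intro of_int_floor sum_frac_integral) auto
  have s_bounds: "\<lfloor>s m j\<rfloor> \<in> {0..<int j}" if "j \<in> {1..<n}" for m j
  proof -
    \<comment> \<open>Strict, as row \<open>j\<close> is nonempty and fractional parts are below 1.
      This leaves \<open>j\<close> values for row \<open>j\<close>, hence the product (n - 1)!
      below.\<close>
    have "s m j < (\<Sum>i=1..j. 1)"
      unfolding s_def using that by (intro sum_strict_mono) (auto simp: frac_lt_1)
    moreover have "0 \<le> s m j"
      unfolding s_def by (intro sum_nonneg) simp
    ultimately show ?thesis
      by (simp add: floor_less_iff)
  qed
  define F where "F m = restrict (\<lambda>j. \<lfloor>s m j\<rfloor>) {1..<n}" for m
  let ?T = "PiE {1..<n} (\<lambda>j. {0..<int j})"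
  have "card ?T = (\<Prod>j\<in>{1..<n}. j)"
    by (simp add: card_PiE)
  also have "\<dots> = fact (n - 1)"
    by (cases n) (simp_all add: fact_prod atLeastLessThanSuc_atLeastAtMost)
  finally have card: "card ?T = fact (n - 1)" .
  have "F ` {0..fact (n - 1)} \<subseteq> ?T"
    using s_bounds unfolding F_def by auto
  moreover have "finite ?T"
    by (intro finite_PiE) auto
  ultimately have "card (F ` {0..fact (n - 1)}) \<le> fact (n - 1)"
    unfolding card[symmetric] by (rule card_mono[rotated])
  \<comment> \<open>Counting 0, there are (n - 1)! + 1 multipliers, one more than the possible
    images.\<close>
  then have "\<not> inj_on F {0..fact (n - 1)}"
    by (intro pigeonhole) simp
  then obtain a b where ab: "a < b" "b \<le> fact (n - 1)" "F a = F b"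
    by (auto simp: inj_on_def) (metis linorder_neqE_nat)
  define g :: "real \<Rightarrow> real" where "g t = frac (of_nat b * t) - frac (of_nat a * t)" for t
  have "\<bar>g t\<bar> \<le> 1" for t
    using frac_lt_1[of "of_nat a * t"] frac_lt_1[of "of_nat b * t"]
      frac_ge_0[of "of_nat a * t"] frac_ge_0[of "of_nat b * t"] unfolding g_def by linarith
  moreover have "g t = 0" if "t \<in> \<int>" for t
    using that unfolding g_def by (metis Ints_mult Ints_of_nat diff_self frac_eq_0_iff)
  moreover have "(\<Sum>i=1..j. g (?l (i, j))) = 0" if "1 \<le> j" "j < n" for j
  proof -
    have "\<lfloor>s a j\<rfloor> = \<lfloor>s b j\<rfloor>"
      using fun_cong[OF ab(3), of j] that by (simp add: F_def)
    then have "s a j = s b j"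
      using s_int[of j a] s_int[of j b] that by (metis atLeastLessThan_iff)
    then show ?thesis
      by (simp add: g_def s_def sum_subtractf)
  qed
  ultimately have g0: "g (?l p) = 0" for p
    by (rule extreme_point_GT_polytope_rigid[where g = g, OF x])
  show thesis
  proof (rule that[of "b - a"])
    fix p
    \<comment> \<open>The equal fractional parts cancel, leaving a difference of floors.\<close>
    have "of_nat (b - a) * ?l p = of_int (\<lfloor>of_nat b * ?l p\<rfloor> - \<lfloor>of_nat a * ?l p\<rfloor>)"
      using g0[of p] ab(1) unfolding g_def frac_def by (simp add: left_diff_distrib)
    then show "of_nat (b - a) * ?l p \<in> \<int>"
      by (metis Ints_of_int)
  qed (use ab in auto)
qed

text \<open>\<open>snd (quotient_of q)\<close> is the positive denominator in lowest terms;
  reduction only divides \<open>d\<close> by a gcd.\<close>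

lemma denominator_le:
  fixes y :: real
  assumes "d \<ge> 1" and "of_nat d * y \<in> \<int>"
  shows "\<exists>q. y = of_rat q \<and> snd (quotient_of q) \<le> int d"
proof -
  from assms(2) obtain k where k: "of_nat d * y = of_int k"
    by (auto elim: Ints_cases)
  define q where "q = Fract k (int d)"
  have "y = of_rat q"
    using k \<open>d \<ge> 1\<close> by (simp add: q_def of_rat_rat field_simps)
  moreover have "snd (quotient_of q) = int d div gcd k (int d)"
    using \<open>d \<ge> 1\<close> by (simp add: q_def quotient_of_Fract Rat.normalize_def Let_def)
  then have "snd (quotient_of q) \<le> int d"
    using \<open>d \<ge> 1\<close> div_by_1[of "int d"] zdiv_mono2[of "int d" 1 "gcd k (int d)"]
    by (simp add: int_one_le_iff_zero_less)
  ultimately show ?thesis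
    by blast
qed

text \<open>Besides the factor 1 there are \<open>k\<close> factors, each at most
  \<open>Suc k\<close>.\<close>

lemma fact_Suc_le_power: "fact (Suc k) \<le> (Suc k ^ k :: nat)"
proof (induction k)
  case (Suc k)
  have "fact (Suc (Suc k)) = Suc (Suc k) * fact (Suc k)"
    by simp
  also have "\<dots> \<le> Suc (Suc k) * Suc k ^ k"
    using Suc by (rule mult_le_mono2)
  also have "\<dots> \<le> Suc (Suc k) * Suc (Suc k) ^ k"
    by (intro mult_le_mono2 power_mono) auto
  finally show ?case
    by simp
qed simp

text \<open>For n = k + 2, Pascal's rule used twice turns the exponent into k + binom(k + 1, 2),
  which exceeds the \<open>k\<close> of \<open>fact_Suc_le_power\<close>; the base n - 1 is at least
  2, so the power grows strictly.\<close>

lemma fact_less_power_choose: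
  assumes "n \<ge> 3"
  shows "fact (n - 1) < (n - 1) ^ (((n + 1) choose 2) - n - 1)"
proof -
  define k where "k = n - 2"
  have n: "n = k + 2" "k \<ge> 1"
    using assms by (auto simp: k_def)
  have "(n + 1) choose 2 = (k + 2) + (k + 1) + (Suc k choose 2)"
    by (simp add: n numeral_2_eq_2)
  moreover have "Suc k choose 2 \<ge> 1"
    using n(2) by (simp add: Suc_le_eq)
  ultimately have "k < ((n + 1) choose 2) - n - 1"
    using n by linarith
  have "fact (n - 1) \<le> (n - 1) ^ k"
    using fact_Suc_le_power[of k] by (simp add: n)
  also have "\<dots> < (n - 1) ^ (((n + 1) choose 2) - n - 1)"
    using assms \<open>k < _\<close> by (intro power_strict_increasing) auto
  finally show ?thesis .
qed

text \<open>For n at most 2 the right-hand side is 1, and no reduced denominator is smaller; hence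
  the assumption \<open>n \<ge> 3\<close>.\<close>

theorem proposition2p5:
  fixes n :: nat and lam mu :: "nat \<Rightarrow> int"
    and x :: "(nat \<times> nat) \<Rightarrow>\<^sub>0 real" and i j :: nat
  assumes "n \<ge> 3"
    and "x extreme_point_of GT_polytope n lam mu"
    and "1 \<le> i" and "i \<le> j" and "j \<le> n"
  shows "\<exists>q :: rat. Poly_Mapping.lookup x (i, j) = of_rat q \<and>
           snd (quotient_of q) < (int n - 1) ^ (((n + 1) choose 2) - n - 1)"
proof -
  obtain d where d: "1 \<le> d" "d \<le> fact (n - 1)"
    and int: "\<And>p. of_nat d * Poly_Mapping.lookup x p \<in> \<int>"
    using extreme_point_GT_polytope_common_denominator[OF assms(2)] by auto
  obtain q where q: "Poly_Mapping.lookup x (i, j) = of_rat q" "snd (quotient_of q) \<le> int d"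
    using denominator_le[OF d(1) int] by blast
  have "d < (n - 1) ^ (((n + 1) choose 2) - n - 1)"
    using d(2) fact_less_power_choose[OF assms(1)] by (rule le_less_trans)
  then have "int d < int ((n - 1) ^ (((n + 1) choose 2) - n - 1))"
    by simp
  also have "\<dots> = (int n - 1) ^ (((n + 1) choose 2) - n - 1)"
    using assms(1) by (simp add: of_nat_diff)
  finally show ?thesis
    using q by force
qed

end
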